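(* Let $p=1$ and $A=[0,\infty)$, i.e. the parameter space is $\{\theta=(\theta_1,\theta_2)\in\mathbb{R}^2:\theta_1\ge\theta_2\}$. For estimating the density of $Y_1$ under Kullback-Leibler loss, the Bayes predictive density $\hat q_{\pi_{U,A}}$ dominates the minimum risk equivariant predictive density estimator $\hat q_{\mathrm{mre}}$. The Kullback-Leibler risks of the two predictive densities are equal at $\theta$ if and only if $\theta_1=\theta_2$.
   Context: Model: $X=(X_1,X_2)$ and $Y_1$, with $X_1\sim N(\theta_1,\sigma_1^2)$, $X_2\sim N(\theta_2,\sigma_2^2)$, $Y_1\sim N(\theta_1,\sigma_Y^2)$ independent, where $\sigma_1^2,\sigma_2^2,\sigma_Y^2>0$ are known and $\theta_1-\theta_2\in A$. Let $q_{\theta_1}$ be the density of $Y_1$. A predictive density is a density $\hat q(\cdot;X)$ on $\mathbb{R}$ depending on $X$, used to estimate $q_{\theta_1}$. Kullback-Leibler loss is $L(\theta,\hat q)=\int q_{\theta_1}(y)\log\frac{q_{\theta_1}(y)}{\hat q(y;x)}\,dy$, and the Kullback-Leibler risk is $R_{KL}(\theta,\hat q)=\mathbb{E}_\theta[L(\theta,\hat q(\cdot;X))]$. A predictive density $\hat q_a$ dominates $\hat q_b$ if $R_{KL}(\theta,\hat q_a)\le R_{KL}(\theta,\hat q_b)$ for all $\theta$ in the parameter space, with strict inequality for at least one such $\theta$. The minimum risk equivariant predictive density $\hat q_{\mathrm{mre}}(\cdot;X)$ (for Kullback-Leibler loss) is the $N(X_1,\sigma_1^2+\sigma_Y^2)$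 density. $\hat q_{\pi_{U,A}}$ is the Bayes predictive density (minimizer of posterior expected Kullback-Leibler loss) for the uniform prior $\pi_{U,A}(\theta)=\mathbb{I}_A(\theta_1-\theta_2)$ on $\mathbb{R}^2$; it is the posterior predictive density $\hat q_{\pi_{U,A}}(y_1;x)=\int q_{\theta_1}(y_1)\,\pi(\theta\mid x)\,d\theta$. *)

theory Defs
  imports "HOL-Probability.Probability"
begin

text \<open>
  Points \<open>(\<theta>1, \<theta>2)\<close> of the parameter space and observations \<open>(x1, x2)\<close> are pairs of reals.
  The parameters \<open>\<sigma>1 \<sigma>2 \<sigma>Y\<close> are standard deviations, as in \<^const>\<open>normal_density\<close>.
\<close>

type_synonym predictive = "real \<times> real \<Rightarrow> real \<Rightarrow> real"

text \<open>
  The integral with values in the extended reals: integral of the positive part minus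
  integral of the negative part.  Unlike the Bochner integral it does not assign the value 0 to
  a divergent integral, so an infinite loss or risk is really infinite.
  (If both parts are infinite, the value is \<open>\<infinity> - \<infinity> = \<infinity>\<close> on \<^typ>\<open>ereal\<close>.)
\<close>

definition ereal_integral :: "'a measure \<Rightarrow> ('a \<Rightarrow> ereal) \<Rightarrow> ereal" where
  "ereal_integral M f =
     enn2ereal (\<integral>\<^sup>+ x. e2ennreal (f x) \<partial>M) - enn2ereal (\<integral>\<^sup>+ x. e2ennreal (- f x) \<partial>M)"

lemma ereal_integral_eq_lebesgue_integral:
  fixes f :: "'a \<Rightarrow> real"
  assumes "integrable M f"
  shows "ereal_integral M (\<lambda>x. ereal (f x)) = ereal (\<integral> x. f x \<partial>M)"
proof -
  have fin: "(\<integral>\<^sup>+ x. ennreal (f x) \<partial>M) \<noteq> \<infinity>" "(\<integral>\<^sup>+ x. ennreal (- f x) \<partial>M) \<noteq> \<infinity>"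
    using assms by (auto simp: real_integrable_def)
  have conv: "enn2ereal a = ereal (enn2real a)" if "a \<noteq> \<infinity>" for a
    using that by (cases a) (auto simp: enn2ereal_ennreal)
  show ?thesis
    unfolding ereal_integral_def real_lebesgue_integral_def[OF assms]
    using conv[OF fin(1)] conv[OF fin(2)] by (simp add: ennreal.rep_eq e2ennreal_ereal)
qed

definition obs_law :: "real \<Rightarrow> real \<Rightarrow> real \<times> real \<Rightarrow> (real \<times> real) measure" where
  "obs_law \<sigma>1 \<sigma>2 \<theta> =
     density lborel (normal_density (fst \<theta>) \<sigma>1) \<Otimes>\<^sub>M density lborel (normal_density (snd \<theta>) \<sigma>2)"

definition likelihood :: "real \<Rightarrow> real \<Rightarrow> real \<times> real \<Rightarrow> real \<times> real \<Rightarrow> real" where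
  "likelihood \<sigma>1 \<sigma>2 \<theta> x =
     normal_density (fst \<theta>) \<sigma>1 (fst x) * normal_density (snd \<theta>) \<sigma>2 (snd x)"

text \<open>
  The integrand of the Kullback-Leibler divergence, with the usual convention
  \<open>p log (p / 0) = \<infinity>\<close> for \<open>p > 0\<close> (on \<^typ>\<open>real\<close>, division by 0 and \<open>ln 0\<close> give 0).
\<close>

definition KL_integrand :: "real \<Rightarrow> real \<Rightarrow> ereal" where
  "KL_integrand p q = (if p > 0 \<and> q = 0 then \<infinity> else ereal (p * ln (p / q)))"

definition KL_loss :: "real \<Rightarrow> real \<times> real \<Rightarrow> (real \<Rightarrow> real) \<Rightarrow> ereal" where
  "KL_loss \<sigma>Y \<theta> q =
     ereal_integral lborel (\<lambda>y. KL_integrand (normal_density (fst \<theta>) \<sigma>Y y) (q y))"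

definition KL_risk :: "real \<Rightarrow> real \<Rightarrow> real \<Rightarrow> real \<times> real \<Rightarrow> predictive \<Rightarrow> ereal" where
  "KL_risk \<sigma>1 \<sigma>2 \<sigma>Y \<theta> q = ereal_integral (obs_law \<sigma>1 \<sigma>2 \<theta>) (\<lambda>x. KL_loss \<sigma>Y \<theta> (q x))"

definition param_space :: "real set \<Rightarrow> (real \<times> real) set" where
  "param_space A = {\<theta>. fst \<theta> - snd \<theta> \<in> A}"

definition dominates ::
    "real \<Rightarrow> real \<Rightarrow> real \<Rightarrow> real set \<Rightarrow> predictive \<Rightarrow> predictive \<Rightarrow> bool" where
  "dominates \<sigma>1 \<sigma>2 \<sigma>Y A qa qb \<longleftrightarrow>
     (\<forall>\<theta> \<in> param_space A. KL_risk \<sigma>1 \<sigma>2 \<sigma>Y \<theta> qa \<le> KL_risk \<sigma>1 \<sigma>2 \<sigma>Y \<theta> qb) \<and>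
     (\<exists>\<theta> \<in> param_space A. KL_risk \<sigma>1 \<sigma>2 \<sigma>Y \<theta> qa < KL_risk \<sigma>1 \<sigma>2 \<sigma>Y \<theta> qb)"

definition q_mre :: "real \<Rightarrow> real \<Rightarrow> predictive" where
  "q_mre \<sigma>1 \<sigma>Y x y = normal_density (fst x) (sqrt (\<sigma>1\<^sup>2 + \<sigma>Y\<^sup>2)) y"

definition uniform_prior :: "real set \<Rightarrow> real \<times> real \<Rightarrow> real" where
  "uniform_prior A \<theta> = indicator A (fst \<theta> - snd \<theta>)"

definition posterior ::
    "real \<Rightarrow> real \<Rightarrow> (real \<times> real \<Rightarrow> real) \<Rightarrow> real \<times> real \<Rightarrow> real \<times> real \<Rightarrow> real" where
  "posterior \<sigma>1 \<sigma>2 \<pi> x \<theta> =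
     likelihood \<sigma>1 \<sigma>2 \<theta> x * \<pi> \<theta> / (\<integral> \<eta>. likelihood \<sigma>1 \<sigma>2 \<eta> x * \<pi> \<eta> \<partial>lborel)"

text \<open>
  The Bayes predictive density under Kullback-Leibler loss, in its explicit form as the posterior
  predictive density.
\<close>

definition q_bayes :: "real \<Rightarrow> real \<Rightarrow> real \<Rightarrow> (real \<times> real \<Rightarrow> real) \<Rightarrow> predictive" where
  "q_bayes \<sigma>1 \<sigma>2 \<sigma>Y \<pi> x y =
     (\<integral> \<theta>. normal_density (fst \<theta>) \<sigma>Y y * posterior \<sigma>1 \<sigma>2 \<pi> x \<theta> \<partial>lborel)"

end

theory Submission
  imports Defs
begin

text \<open>
  Write \<open>\<Phi>\<close> for the standard normal distribution function, \<open>\<Delta> = \<theta>1 - \<theta>2\<close>, and let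
  \<open>M = (\<sigma>Y\<^sup>2 X1 + \<sigma>1\<^sup>2 Y1) / (\<sigma>1\<^sup>2 + \<sigma>Y\<^sup>2)\<close> be the best unbiased combination of \<open>X1\<close> and \<open>Y1\<close>, with
  variance \<open>\<tau>\<^sup>2 = \<sigma>1\<^sup>2 \<sigma>Y\<^sup>2 / (\<sigma>1\<^sup>2 + \<sigma>Y\<^sup>2)\<close>.  Put \<open>s\<^sup>2 = \<sigma>1\<^sup>2 + \<sigma>2\<^sup>2\<close> and \<open>s'\<^sup>2 = \<tau>\<^sup>2 + \<sigma>2\<^sup>2\<close>.

  The Bayes predictive density is the minimum risk equivariant one multiplied by the factor
  \<open>\<Phi>((M - X2) / s') / \<Phi>((X1 - X2) / s)\<close> (lemma \<open>q_bayes_uniform_prior_half_plane\<close>): numerator and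
  denominator are the posterior probabilities of \<open>\<theta>1 \<ge> \<theta>2\<close> after and before \<open>Y1\<close> is seen.  So
  the risk of the equivariant density exceeds that of the Bayes density by
  \<open>E ln \<Phi>((M - X2) / s') - E ln \<Phi>((X1 - X2) / s)\<close>.

  Both arguments of \<open>\<Phi>\<close> are normal with variance 1, and their means are \<open>\<Delta> / s'\<close> and \<open>\<Delta> / s\<close>.  With
  \<open>G(\<mu>) = E ln \<Phi>(\<mu> + Z)\<close> for standard normal \<open>Z\<close>, the gain is therefore
  \<open>G(\<Delta> / s') - G(\<Delta> / s)\<close> (lemma \<open>KL_risk_q_mre_q_bayes\<close>).  The function \<open>G\<close> is strictly
  increasing (lemma \<open>mean_ln_cdf_strict_mono\<close>) and \<open>s' < s\<close>, so the gain is zero for \<open>\<Delta> = 0\<close> and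
  positive for \<open>\<Delta> > 0\<close>.

  The subtraction of risks requires them to be finite.  This rests on the bound
  \<open>\<bar>ln (\<Phi> t)\<bar> \<le> t\<^sup>2 + const\<close> (lemma \<open>abs_ln_std_normal_cdf_le\<close>) and on the finite second moments of
  normal variables.
\<close>

section \<open>Products of normal densities\<close>

lemma normal_density_swap: "normal_density m s x = normal_density x s m"
  by (simp add: normal_density_def power2_commute)

text \<open>
  Completing the square in \<open>u\<close>: read \<open>u\<close> as a mean with prior \<open>N(x, s\<^sup>2)\<close> and \<open>y\<close> as an
  observation of it with variance \<open>t\<^sup>2\<close>.  The joint density is the marginal of \<open>y\<close> times the
  posterior of \<open>u\<close>, whose mean is the precision-weighted average of \<open>x\<close> and \<open>y\<close>.
\<close>

lemma normal_density_mult: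
  fixes s t :: real
  assumes [arith]: "0 < s" "0 < t"
  shows "normal_density y t u * normal_density x s u =
    normal_density x (sqrt (s\<^sup>2 + t\<^sup>2)) y *
    normal_density ((t\<^sup>2 * x + s\<^sup>2 * y) / (s\<^sup>2 + t\<^sup>2)) (s * t / sqrt (s\<^sup>2 + t\<^sup>2)) u"
proof -
  define v where "v = s\<^sup>2 + t\<^sup>2"
  have v: "0 < v" by (simp add: v_def add_pos_pos)
  have scale: "sqrt (2 * pi * t\<^sup>2) * sqrt (2 * pi * s\<^sup>2)
      = sqrt (2 * pi * v) * sqrt (2 * pi * (s * t / sqrt v)\<^sup>2)"
    using v by (simp add: real_sqrt_mult[symmetric] power_divide power_mult_distrib)
  have expo: "- (u - y)\<^sup>2 / (2 * t\<^sup>2) + - (u - x)\<^sup>2 / (2 * s\<^sup>2)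
      = - (y - x)\<^sup>2 / (2 * v) + - (u - (t\<^sup>2 * x + s\<^sup>2 * y) / v)\<^sup>2 / (2 * (s\<^sup>2 * t\<^sup>2 / v))"
  proof -
    have "(s\<^sup>2 + t\<^sup>2) \<noteq> 0" "s \<noteq> 0" "t \<noteq> 0" using v v_def by auto
    then show ?thesis unfolding v_def
      by (simp add: divide_simps) algebra
  qed
  have e2: "(s * t / sqrt v)\<^sup>2 = s\<^sup>2 * t\<^sup>2 / v" "(sqrt v)\<^sup>2 = v"
    using v by (simp_all add: power_divide power_mult_distrib)
  have "normal_density y t u * normal_density x s u
      = exp (- (u - y)\<^sup>2 / (2 * t\<^sup>2) + - (u - x)\<^sup>2 / (2 * s\<^sup>2)) /
        (sqrt (2 * pi * t\<^sup>2) * sqrt (2 * pi * s\<^sup>2))"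
    by (simp add: normal_density_def mult_exp_exp)
  also have "\<dots> = normal_density x (sqrt v) y *
      normal_density ((t\<^sup>2 * x + s\<^sup>2 * y) / v) (s * t / sqrt v) u"
    unfolding expo scale exp_add by (simp add: normal_density_def e2)
  finally show ?thesis by (simp add: v_def)
qed

section \<open>Normal random variables on product spaces\<close>

abbreviation normal_law :: "real \<Rightarrow> real \<Rightarrow> real measure" where
  "normal_law \<mu> \<sigma> \<equiv> density lborel (normal_density \<mu> \<sigma>)"

lemma distributed_normal_law:
  "distributed (normal_law \<mu> \<sigma>) lborel (\<lambda>x. x) (normal_density \<mu> \<sigma>)"
  by (auto simp: distributed_def intro!: measure_eqI simp: emeasure_distr)

lemma distributed_pair_fst:
  assumes "prob_space N" and X: "distributed M lborel X f"
  shows "distributed (M \<Otimes>\<^sub>M N) lborel (\<lambda>\<omega>. X (fst \<omega>)) f"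
proof -
  have [measurable]: "X \<in> borel_measurable M" using X by (auto simp: distributed_def)
  have "distr (M \<Otimes>\<^sub>M N) lborel (\<lambda>\<omega>. X (fst \<omega>)) = distr (distr (M \<Otimes>\<^sub>M N) M fst) lborel X"
    by (subst distr_distr) (auto simp: comp_def)
  also have "\<dots> = density lborel f"
    using X by (simp add: prob_space.distr_pair_fst[OF assms(1)] distributed_distr_eq_density)
  finally show ?thesis using X by (auto simp: distributed_def)
qed

lemma distributed_pair_snd:
  assumes "prob_space M" "prob_space N" and X: "distributed N lborel X f"
  shows "distributed (M \<Otimes>\<^sub>M N) lborel (\<lambda>\<omega>. X (snd \<omega>)) f"
proof -
  interpret M: prob_space M by fact
  interpret N: prob_space N by fact
  interpret pair_sigma_finite M N ..
  have [measurable]: "X \<in> borel_measurable N" using X by (auto simp: distributed_def)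
  have "distr (M \<Otimes>\<^sub>M N) lborel (\<lambda>\<omega>. X (snd \<omega>)) = distr (N \<Otimes>\<^sub>M M) lborel (\<lambda>\<omega>. X (fst \<omega>))"
    by (subst distr_pair_swap, subst distr_distr) (auto simp: comp_def case_prod_beta)
  also have "\<dots> = density lborel f"
    using distributed_pair_fst[OF assms(1) X] by (simp add: distributed_distr_eq_density)
  finally show ?thesis using X by (auto simp: distributed_def)
qed

text \<open>
  Linear combinations of the observations and of the future value are handled coordinate by
  coordinate; independence of functions of different coordinates is what makes
  variances add.
\<close>

lemma indep_var_pair_fst_snd:
  assumes "prob_space M" "prob_space N"
    and [measurable]: "X \<in> borel_measurable M" "Y \<in> borel_measurable N"
  shows "prob_space.indep_var (M \<Otimes>\<^sub>M N) borel (\<lambda>\<omega>. X (fst \<omega>)) borel (\<lambda>\<omega>. Y (snd \<omega>))"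
proof -
  interpret M: prob_space M by fact
  interpret N: prob_space N by fact
  interpret P: pair_prob_space M N ..
  have X: "distr (M \<Otimes>\<^sub>M N) borel (\<lambda>\<omega>. X (fst \<omega>)) = distr M borel X"
    by (subst (2) N.distr_pair_fst[symmetric], subst distr_distr) (auto simp: comp_def)
  have "distr (M \<Otimes>\<^sub>M N) borel (\<lambda>\<omega>. Y (snd \<omega>)) = distr (N \<Otimes>\<^sub>M M) borel (\<lambda>\<omega>. Y (fst \<omega>))"
    by (subst P.distr_pair_swap, subst distr_distr) (auto simp: comp_def case_prod_beta)
  also have "\<dots> = distr N borel Y"
    by (subst (2) M.distr_pair_fst[symmetric], subst distr_distr) (auto simp: comp_def)
  finally have Y: "distr (M \<Otimes>\<^sub>M N) borel (\<lambda>\<omega>. Y (snd \<omega>)) = distr N borel Y" .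
  have "distr M borel X \<Otimes>\<^sub>M distr N borel Y
      = distr (M \<Otimes>\<^sub>M N) (borel \<Otimes>\<^sub>M borel) (\<lambda>\<omega>. (X (fst \<omega>), Y (snd \<omega>)))"
    by (subst pair_measure_distr)
      (auto simp: case_prod_unfold intro!: prob_space_imp_sigma_finite N.prob_space_distr)
  then show ?thesis
    by (simp add: P.indep_var_distribution_eq X Y)
qed

lemma distributed_pair_add_normal:
  assumes MN: "prob_space M" "prob_space N"
    and pos: "0 < \<sigma>" "0 < \<tau>"
    and X: "distributed M lborel X (normal_density \<mu> \<sigma>)"
    and Y: "distributed N lborel Y (normal_density \<nu> \<tau>)"
  shows "distributed (M \<Otimes>\<^sub>M N) lborel (\<lambda>\<omega>. X (fst \<omega>) + Y (snd \<omega>))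
    (normal_density (\<mu> + \<nu>) (sqrt (\<sigma>\<^sup>2 + \<tau>\<^sup>2)))"
proof -
  interpret P: prob_space "M \<Otimes>\<^sub>M N" using MN by (rule prob_space_pair)
  have "X \<in> borel_measurable M" "Y \<in> borel_measurable N"
    using X Y by (auto simp: distributed_def)
  then show ?thesis
    by (intro P.add_indep_normal indep_var_pair_fst_snd distributed_pair_fst
        distributed_pair_snd MN pos X Y)
qed

lemma distributed_normal_scale:
  assumes "prob_space M" "0 < \<sigma>" "\<alpha> \<noteq> 0" "distributed M lborel X (normal_density \<mu> \<sigma>)"
  shows "distributed M lborel (\<lambda>x. \<alpha> * X x) (normal_density (\<alpha> * \<mu>) (\<bar>\<alpha>\<bar> * \<sigma>))"
  using prob_space.normal_density_affine[OF assms(1,4,2,3), of 0] by simp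

section \<open>The standard normal distribution function and its logarithm\<close>

abbreviation std_normal_cdf :: "real \<Rightarrow> real" where
  "std_normal_cdf \<equiv> cdf std_normal_distribution"

text \<open>
  An interval \<open>{a<..b}\<close> with \<open>a < b\<close> has positive Lebesgue measure and the normal density vanishes
  nowhere, so the interval is not a null set of the normal law.
\<close>

lemma std_normal_cdf_strict_mono: "strict_mono std_normal_cdf"
proof (rule strict_monoI)
  fix a b :: real assume "a < b"
  interpret real_distribution std_normal_distribution by (rule real_dist_normal_dist)
  have pos: "\<not> std_normal_density x \<le> 0" for x
    using normal_density_pos[of 1 0 x] by simp
  have "{a<..b} \<notin> null_sets std_normal_distribution"
  proof
    assume "{a<..b} \<in> null_sets std_normal_distribution"
    then have "AE x in lborel. x \<in> {a<..b} \<longrightarrow> ennreal (std_normal_density x) = 0"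
      by (simp add: null_sets_density_iff)
    then have "AE x in lborel. x \<notin> {a<..b}"
      by eventually_elim (auto simp: ennreal_eq_0_iff pos)
    then have "emeasure lborel {a<..b} = 0"
      by (subst (asm) AE_iff_measurable[where N="{a<..b}"]) auto
    with \<open>a < b\<close> show False by simp
  qed
  then have "measure std_normal_distribution {a<..b} \<noteq> 0"
    by (auto simp: null_sets_def emeasure_eq_measure)
  then show "std_normal_cdf a < std_normal_cdf b"
    using cdf_diff_eq[OF \<open>a < b\<close>] measure_nonneg[of std_normal_distribution "{a<..b}"] by linarith
qed

text \<open>
  The lower bound comes from the mass of the unit interval \<open>{t-1<..t}\<close>, on which
  \<open>z\<^sup>2 \<le> (\<bar>t\<bar> + 1)\<^sup>2 \<le> 2 * t\<^sup>2 + 2\<close>.  It is crude, but it shows that the logarithm of the distribution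
  function grows at most quadratically, and this is all that integrability needs.
\<close>

lemma std_normal_cdf_bounds: 
  "exp (- (t\<^sup>2 + 1)) / sqrt (2 * pi) \<le> std_normal_cdf t" "std_normal_cdf t \<le> 1"
proof -
  interpret real_distribution std_normal_distribution by (rule real_dist_normal_dist)
  show "std_normal_cdf t \<le> 1" by (rule cdf_bounded_prob)
  let ?c = "exp (- (t\<^sup>2 + 1)) / sqrt (2 * pi)"
  have le: "?c \<le> std_normal_density z" if z: "z \<in> {t-1<..t}" for z
  proof -
    have "z\<^sup>2 \<le> (\<bar>t\<bar> + 1)\<^sup>2" by (rule power2_le_iff_abs_le[THEN iffD2]) (use z in auto)
    moreover have "(\<bar>t\<bar> + 1)\<^sup>2 \<le> 2 * t\<^sup>2 + 2"
      using zero_le_power2[of "\<bar>t\<bar> - 1"] by (simp add: power2_eq_square algebra_simps)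
    ultimately have "- (t\<^sup>2 + 1) \<le> - z\<^sup>2 / 2" by simp
    then show ?thesis unfolding std_normal_density_def by (simp add: divide_right_mono)
  qed
  have "ennreal ?c = (\<integral>\<^sup>+z. ennreal ?c * indicator {t-1<..t} z \<partial>lborel)"
    by (simp add: nn_integral_cmult_indicator)
  also have "\<dots> \<le> (\<integral>\<^sup>+z. ennreal (std_normal_density z) * indicator {t-1<..t} z \<partial>lborel)"
    using le by (intro nn_integral_mono) (auto split: split_indicator intro!: ennreal_leI)
  also have "\<dots> = emeasure std_normal_distribution {t-1<..t}"
    by (simp add: emeasure_density)
  also have "\<dots> \<le> emeasure std_normal_distribution {..t}"
    by (intro emeasure_mono) auto
  finally show "?c \<le> std_normal_cdf t"
    by (simp add: emeasure_eq_measure cdf_def)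
qed

lemma std_normal_cdf_pos: "0 < std_normal_cdf t"
  by (rule less_le_trans[OF _ std_normal_cdf_bounds(1)]) simp

lemma abs_ln_std_normal_cdf_le: "\<bar>ln (std_normal_cdf t)\<bar> \<le> t\<^sup>2 + (1 + ln (sqrt (2 * pi)))"
proof -
  have "ln (exp (- (t\<^sup>2 + 1)) / sqrt (2 * pi)) \<le> ln (std_normal_cdf t)"
    using std_normal_cdf_bounds(1)[of t] std_normal_cdf_pos[of t] by (subst ln_le_cancel_iff) auto
  moreover have "ln (exp (- (t\<^sup>2 + 1)) / sqrt (2 * pi)) = - (t\<^sup>2 + 1) - ln (sqrt (2 * pi))"
    by (subst ln_div) auto
  moreover have "ln (std_normal_cdf t) \<le> 0"
    using std_normal_cdf_bounds(2)[of t] std_normal_cdf_pos[of t] by simp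
  ultimately show ?thesis by linarith
qed

lemma borel_measurable_std_normal_cdf [measurable]: "std_normal_cdf \<in> borel_measurable borel"
  by (intro borel_measurable_mono strict_mono_mono std_normal_cdf_strict_mono)

lemma integrable_normal_square_dist:
  assumes s: "0 < s" and X: "distributed M lborel X (normal_density m s)"
  shows "integrable M (\<lambda>\<omega>. (X \<omega> - c)\<^sup>2)"
proof -
  have "integrable lborel (\<lambda>x. normal_density m s x * (x - m)^2
      + (2 * (m - c)) * (normal_density m s x * (x - m)^1) + (m - c)\<^sup>2 * normal_density m s x)"
    by (intro Bochner_Integration.integrable_add integrable_mult_right integrable_normal_moment
        integrable_normal_density s)
  also have "(\<lambda>x. normal_density m s x * (x - m)^2
      + (2 * (m - c)) * (normal_density m s x * (x - m)^1) + (m - c)\<^sup>2 * normal_density m s x)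
      = (\<lambda>x. normal_density m s x * (x - c)\<^sup>2)"
    by (auto simp: power2_eq_square algebra_simps)
  finally show ?thesis
    using distributed_integrable[OF X, of "\<lambda>x. (x - c)\<^sup>2"] by simp
qed

lemma integrable_ln_std_normal_cdf:
  assumes "prob_space M" "0 < s" and X: "distributed M lborel X (normal_density m s)"
  shows "integrable M (\<lambda>\<omega>. ln (std_normal_cdf (X \<omega>)))"
proof (rule Bochner_Integration.integrable_bound)
  interpret prob_space M by fact
  show "integrable M (\<lambda>\<omega>. (X \<omega> - 0)\<^sup>2 + (1 + ln (sqrt (2 * pi))))"
    by (intro Bochner_Integration.integrable_add integrable_const
        integrable_normal_square_dist[OF assms(2,3)])
  have [measurable]: "X \<in> borel_measurable M" using X by (auto simp: distributed_def)
  show "(\<lambda>\<omega>. ln (std_normal_cdf (X \<omega>))) \<in> borel_measurable M" by measurable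
  show "AE \<omega> in M. norm (ln (std_normal_cdf (X \<omega>)))
      \<le> norm ((X \<omega> - 0)\<^sup>2 + (1 + ln (sqrt (2 * pi))))"
    using abs_ln_std_normal_cdf_le by (auto intro!: AE_I2 order_trans[OF _ abs_ge_self])
qed

text \<open>
  The mean of \<open>ln (\<Phi> Z)\<close> for \<open>Z\<close> normal with mean \<open>\<mu>\<close> and unit variance, where \<open>\<Phi>\<close> is the standard
  normal distribution function.  Both terms of the risk difference are values of this function.
\<close>

definition mean_ln_cdf :: "real \<Rightarrow> real" where
  "mean_ln_cdf \<mu> = (\<integral>z. ln (std_normal_cdf z) \<partial>normal_law \<mu> 1)"

lemma integral_ln_std_normal_cdf:
  assumes X: "distributed M lborel X (normal_density \<mu> 1)"
  shows "(\<integral>\<omega>. ln (std_normal_cdf (X \<omega>)) \<partial>M) = mean_ln_cdf \<mu>"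
proof -
  have "(\<integral>\<omega>. ln (std_normal_cdf (X \<omega>)) \<partial>M)
      = (\<integral>z. ln (std_normal_cdf z) \<partial>distr M lborel X)"
    using X by (subst integral_distr) (auto simp: distributed_def)
  then show ?thesis
    by (simp add: mean_ln_cdf_def distributed_distr_eq_density[OF X])
qed

text \<open>
  With \<open>Z\<close> standard normal, \<open>\<mu> + Z\<close> has the law in the definition of \<^const>\<open>mean_ln_cdf\<close>, and
  \<open>ln (\<Phi> (\<mu> + Z))\<close> is strictly increasing in \<open>\<mu>\<close> for every value of \<open>Z\<close>.
\<close>

lemma mean_ln_cdf_strict_mono: "strict_mono mean_ln_cdf"
proof (rule strict_monoI)
  fix a b :: real assume "a < b"
  interpret real_distribution std_normal_distribution by (rule real_dist_normal_dist)
  have D: "distributed std_normal_distribution lborel (\<lambda>z. \<mu> + z) (normal_density \<mu> 1)" for \<mu>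
    using normal_density_affine[OF distributed_normal_law, of 1 \<mu>] by simp
  have "(\<integral>z. ln (std_normal_cdf (a + z)) \<partial>std_normal_distribution)
      < (\<integral>z. ln (std_normal_cdf (b + z)) \<partial>std_normal_distribution)"
    using \<open>a < b\<close>
    by (intro integral_less_AE_space integrable_ln_std_normal_cdf[OF _ _ D])
      (auto simp: prob_space_axioms emeasure_space_1[simplified]
        strict_mono_less[OF std_normal_cdf_strict_mono] std_normal_cdf_pos)
  then show "mean_ln_cdf a < mean_ln_cdf b"
    by (simp add: integral_ln_std_normal_cdf[OF D])
qed

section \<open>The Bayes predictive density in closed form\<close>

text \<open>
  The integral is the probability of \<open>U \<ge> V\<close> for independent normal variables \<open>U\<close> and \<open>V\<close> with means
  \<open>a\<close> and \<open>b\<close>; standardize \<open>V - U\<close>.  This single formula gives the normalizing constant of the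
  posterior (\<open>U, V\<close> are then the parameters given \<open>x\<close>) and, after the square has been completed,
  the numerator of the predictive density (the parameters given \<open>x\<close> and \<open>y\<close>).
\<close>

lemma integral_normal_half_plane:
  fixes s t :: real
  assumes st: "0 < s" "0 < t"
  shows "(\<integral>\<theta>. normal_density a s (fst \<theta>) * normal_density b t (snd \<theta>) *
      indicator {0..} (fst \<theta> - snd \<theta>) \<partial>lborel) = std_normal_cdf ((a - b) / sqrt (s\<^sup>2 + t\<^sup>2))"
proof -
  define r where "r = sqrt (s\<^sup>2 + t\<^sup>2)"
  have r: "0 < r" unfolding r_def using st by (simp add: add_pos_pos)
  let ?M = "normal_law a s \<Otimes>\<^sub>M normal_law b t"
  have ps: "prob_space (normal_law a s)" "prob_space (normal_law b t)"
    using st by (auto intro: prob_space_normal_density)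
  interpret M: prob_space ?M by (rule prob_space_pair[OF ps])
  have M_density: "?M = density lborel
      (\<lambda>\<theta>. ennreal (normal_density a s (fst \<theta>) * normal_density b t (snd \<theta>)))"
    by (subst pair_measure_density)
      (auto simp: lborel_prod ennreal_mult case_prod_unfold lborel.sigma_finite_measure_axioms
        intro!: prob_space_imp_sigma_finite ps)
  define Z where "Z \<theta> = (((-1) * fst \<theta> + snd \<theta>) - (- a + b)) / r" for \<theta> :: "real \<times> real"
  have Z: "distributed ?M lborel Z std_normal_density"
  proof -
    have "distributed ?M lborel (\<lambda>\<theta>. (-1) * fst \<theta> + snd \<theta>)
        (normal_density ((-1) * a + b) (sqrt ((\<bar>-1\<bar> * s)\<^sup>2 + t\<^sup>2)))"
      using st by (intro distributed_pair_add_normal[OF ps _ _ 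
          distributed_normal_scale[OF ps(1)]] distributed_normal_law) auto
    then show ?thesis
      using M.normal_standard_normal_convert[OF r] by (simp add: Z_def[abs_def] r_def)
  qed
  have [measurable]: "fst \<in> borel_measurable (borel :: (real \<times> real) measure)"
      "snd \<in> borel_measurable (borel :: (real \<times> real) measure)"
    by (simp_all add: borel_prod[symmetric])
  have ind: "indicator {0..} (fst \<theta> - snd \<theta>) = (indicator {..(a - b) / r} (Z \<theta>) :: real)" for \<theta>
    using r by (auto simp: Z_def divide_le_cancel split: split_indicator)
  have "(\<integral>\<theta>. normal_density a s (fst \<theta>) * normal_density b t (snd \<theta>) *
      indicator {0..} (fst \<theta> - snd \<theta>) \<partial>lborel)
      = (\<integral>\<theta>. indicator {..(a - b) / r} (Z \<theta>) \<partial>?M)"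
    unfolding M_density ind[symmetric]
    by (subst integral_density) auto
  also have "\<dots> = (\<integral>z. indicator {..(a - b) / r} z \<partial>distr ?M lborel Z)"
    using Z by (subst integral_distr) (auto simp: distributed_def)
  also have "\<dots> = std_normal_cdf ((a - b) / r)"
    by (simp add: distributed_distr_eq_density[OF Z] cdf_def)
  finally show ?thesis by (simp add: r_def)
qed

text \<open>
  The constraint \<open>\<theta>1 \<ge> \<theta>2\<close> tilts the unconstrained predictive density by the ratio of the
  posterior probabilities of the constraint given \<open>(x, y)\<close> and given \<open>x\<close>, both computed with
  the flat prior on the whole plane.
\<close>

lemma q_bayes_uniform_prior_half_plane:
  assumes \<sigma>: "0 < \<sigma>1" "0 < \<sigma>2" "0 < \<sigma>Y"
  shows "q_bayes \<sigma>1 \<sigma>2 \<sigma>Y (uniform_prior {0..}) x y = q_mre \<sigma>1 \<sigma>Y x y *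
      (std_normal_cdf (((\<sigma>Y\<^sup>2 * fst x + \<sigma>1\<^sup>2 * y) / (\<sigma>1\<^sup>2 + \<sigma>Y\<^sup>2) - snd x) /
          sqrt ((\<sigma>1 * \<sigma>Y / sqrt (\<sigma>1\<^sup>2 + \<sigma>Y\<^sup>2))\<^sup>2 + \<sigma>2\<^sup>2)) /
       std_normal_cdf ((fst x - snd x) / sqrt (\<sigma>1\<^sup>2 + \<sigma>2\<^sup>2)))"
proof -
  have lik: "likelihood \<sigma>1 \<sigma>2 \<eta> x * uniform_prior {0..} \<eta> =
      normal_density (fst x) \<sigma>1 (fst \<eta>) * normal_density (snd x) \<sigma>2 (snd \<eta>) *
      indicator {0..} (fst \<eta> - snd \<eta>)" for \<eta>
    by (simp add: likelihood_def uniform_prior_def normal_density_swap[of _ _ "fst x"]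
        normal_density_swap[of _ _ "snd x"])
  define D where "D = std_normal_cdf ((fst x - snd x) / sqrt (\<sigma>1\<^sup>2 + \<sigma>2\<^sup>2))"
  have D: "(\<integral> \<eta>. likelihood \<sigma>1 \<sigma>2 \<eta> x * uniform_prior {0..} \<eta> \<partial>lborel) = D"
    unfolding lik D_def by (rule integral_normal_half_plane[OF \<sigma>(1,2)])
  define m where "m = (\<sigma>Y\<^sup>2 * fst x + \<sigma>1\<^sup>2 * y) / (\<sigma>1\<^sup>2 + \<sigma>Y\<^sup>2)"
  define \<tau> where "\<tau> = \<sigma>1 * \<sigma>Y / sqrt (\<sigma>1\<^sup>2 + \<sigma>Y\<^sup>2)"
  have \<tau>: "0 < \<tau>" unfolding \<tau>_def using \<sigma> by (simp add: add_pos_pos)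
  have num: "normal_density (fst \<eta>) \<sigma>Y y * posterior \<sigma>1 \<sigma>2 (uniform_prior {0..}) x \<eta> =
      (q_mre \<sigma>1 \<sigma>Y x y / D) * (normal_density m \<tau> (fst \<eta>) * normal_density (snd x) \<sigma>2 (snd \<eta>) *
      indicator {0..} (fst \<eta> - snd \<eta>))" for \<eta>
  proof -
    have "normal_density (fst \<eta>) \<sigma>Y y * posterior \<sigma>1 \<sigma>2 (uniform_prior {0..}) x \<eta> =
        (normal_density y \<sigma>Y (fst \<eta>) * normal_density (fst x) \<sigma>1 (fst \<eta>)) / D *
        (normal_density (snd x) \<sigma>2 (snd \<eta>) * indicator {0..} (fst \<eta> - snd \<eta>))"
      unfolding posterior_def D unfolding lik
      by (simp add: normal_density_swap[of "fst \<eta>" _ y])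
    also have "normal_density y \<sigma>Y (fst \<eta>) * normal_density (fst x) \<sigma>1 (fst \<eta>) =
        q_mre \<sigma>1 \<sigma>Y x y * normal_density m \<tau> (fst \<eta>)"
      unfolding q_mre_def m_def \<tau>_def by (rule normal_density_mult[OF \<sigma>(1,3)])
    finally show ?thesis by simp
  qed
  show ?thesis
    unfolding q_bayes_def num integral_mult_right_zero integral_normal_half_plane[OF \<tau> \<sigma>(2)]
    by (simp add: D_def m_def \<tau>_def)
qed

section \<open>The Kullback-Leibler risks\<close>

text \<open>
  Fubini's theorem: for a positive predictive density whose log-likelihood ratio is integrable
  jointly in observation and future value, almost every loss is finite, so the integrals over the extended
  reals are ordinary ones and the risk is a single expectation over the product space.
\<close>

lemma KL_risk_eq_integral:
  assumes \<sigma>: "0 < \<sigma>1" "0 < \<sigma>2" "0 < \<sigma>Y"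
    and pos: "\<And>x y. 0 < q x y"
    and int: "integrable (obs_law \<sigma>1 \<sigma>2 \<theta> \<Otimes>\<^sub>M normal_law (fst \<theta>) \<sigma>Y)
      (\<lambda>\<omega>. ln (normal_density (fst \<theta>) \<sigma>Y (snd \<omega>) / q (fst \<omega>) (snd \<omega>)))"
  shows "KL_risk \<sigma>1 \<sigma>2 \<sigma>Y \<theta> q =
    ereal (\<integral>\<omega>. ln (normal_density (fst \<theta>) \<sigma>Y (snd \<omega>) / q (fst \<omega>) (snd \<omega>))
      \<partial>(obs_law \<sigma>1 \<sigma>2 \<theta> \<Otimes>\<^sub>M normal_law (fst \<theta>) \<sigma>Y))"
proof -
  let ?O = "obs_law \<sigma>1 \<sigma>2 \<theta>" and ?N = "normal_law (fst \<theta>) \<sigma>Y"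
  let ?p = "normal_density (fst \<theta>) \<sigma>Y"
  interpret O: prob_space ?O
    unfolding obs_law_def using \<sigma> by (intro prob_space_pair prob_space_normal_density)
  interpret N: prob_space ?N using \<sigma> by (intro prob_space_normal_density)
  interpret P: pair_sigma_finite ?O ?N ..
  have loss: "KL_loss \<sigma>Y \<theta> (q x) = ereal (\<integral>y. ln (?p y / q x y) \<partial>?N)"
    if I: "integrable ?N (\<lambda>y. ln (?p y / q x y))" for x
  proof -
    have [measurable]: "(\<lambda>y. ln (?p y / q x y)) \<in> borel_measurable borel"
      using borel_measurable_integrable[OF I] by simp
    have "q x y \<noteq> 0" for y using pos[of x y] by simp
    then have "KL_loss \<sigma>Y \<theta> (q x) = ereal_integral lborel (\<lambda>y. ereal (?p y * ln (?p y / q x y)))"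
      by (simp add: KL_loss_def KL_integrand_def)
    also have "\<dots> = ereal (\<integral>y. ?p y * ln (?p y / q x y) \<partial>lborel)"
      using I by (intro ereal_integral_eq_lebesgue_integral) (subst (asm) integrable_real_density, auto)
    also have "(\<integral>y. ?p y * ln (?p y / q x y) \<partial>lborel) = (\<integral>y. ln (?p y / q x y) \<partial>?N)"
      by (subst integral_real_density) auto
    finally show ?thesis .
  qed
  have "AE x in ?O. integrable ?N (\<lambda>y. ln (?p y / q x y))"
    using P.AE_integrable_fst'[OF int] by simp
  then have ae: "AE x in ?O. KL_loss \<sigma>Y \<theta> (q x) = ereal (\<integral>y. ln (?p y / q x y) \<partial>?N)"
    by eventually_elim (rule loss)
  have "KL_risk \<sigma>1 \<sigma>2 \<sigma>Y \<theta> q = ereal_integral ?O (\<lambda>x. ereal (\<integral>y. ln (?p y / q x y) \<partial>?N))"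
    unfolding KL_risk_def ereal_integral_def
    by (intro arg_cong2[where f = "(-)"] arg_cong[where f = enn2ereal] nn_integral_cong_AE)
      (use ae in eventually_elim, simp)+
  also have "\<dots> = ereal (\<integral>x. (\<integral>y. ln (?p y / q x y) \<partial>?N) \<partial>?O)"
    using P.integrable_fst'[OF int] by (intro ereal_integral_eq_lebesgue_integral) simp
  also have "(\<integral>x. (\<integral>y. ln (?p y / q x y) \<partial>?N) \<partial>?O)
      = (\<integral>\<omega>. ln (?p (snd \<omega>) / q (fst \<omega>) (snd \<omega>)) \<partial>(?O \<Otimes>\<^sub>M ?N))"
    using P.integral_fst'[OF int] by simp
  finally show ?thesis .
qed

lemma ln_normal_density:
  "0 < s \<Longrightarrow> ln (normal_density m s x) = - ln (sqrt (2 * pi * s\<^sup>2)) - (x - m)\<^sup>2 / (2 * s\<^sup>2)"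
  unfolding normal_density_def by (subst ln_mult) (auto simp: ln_div)

lemma integrable_ln_normal_density:
  assumes "prob_space M" "0 < s" "0 < t" and X: "distributed M lborel X (normal_density m s)"
  shows "integrable M (\<lambda>\<omega>. ln (normal_density c t (X \<omega>)))"
proof -
  interpret prob_space M by fact
  show ?thesis
    unfolding ln_normal_density[OF \<open>0 < t\<close>]
    by (intro Bochner_Integration.integrable_diff integrable_const integrable_divide
        integrable_normal_square_dist[OF assms(2) X])
qed

text \<open>
  By the closed form, the two log-likelihood ratios differ by \<open>ln (\<Phi> W) - ln (\<Phi> T)\<close>, where \<open>T\<close> and
  \<open>W\<close> are the standardized values of \<open>X1 - X2\<close> and of \<open>M - X2\<close>, and \<open>M\<close> is the precision-weighted
  average of \<open>X1\<close> and \<open>Y1\<close>.  The variance by which the posterior calculation scales each difference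
  is also its sampling variance.  Hence \<open>T\<close> and \<open>W\<close> have unit variance, and their means are
  \<open>\<theta>1 - \<theta>2\<close> divided by the respective standard deviations.  The common risk term \<open>R\<close> only has to be
  finite.
\<close>

lemma KL_risk_q_mre_q_bayes:
  fixes \<sigma>1 \<sigma>2 \<sigma>Y :: real
  assumes \<sigma>: "0 < \<sigma>1" "0 < \<sigma>2" "0 < \<sigma>Y"
  obtains R where "KL_risk \<sigma>1 \<sigma>2 \<sigma>Y \<theta> (q_mre \<sigma>1 \<sigma>Y) = ereal R"
    "KL_risk \<sigma>1 \<sigma>2 \<sigma>Y \<theta> (q_bayes \<sigma>1 \<sigma>2 \<sigma>Y (uniform_prior {0..})) =
      ereal (R - (mean_ln_cdf ((fst \<theta> - snd \<theta>) / sqrt ((\<sigma>1 * \<sigma>Y / sqrt (\<sigma>1\<^sup>2 + \<sigma>Y\<^sup>2))\<^sup>2 + \<sigma>2\<^sup>2))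
        - mean_ln_cdf ((fst \<theta> - snd \<theta>) / sqrt (\<sigma>1\<^sup>2 + \<sigma>2\<^sup>2))))"
proof -
  define v where "v = \<sigma>1\<^sup>2 + \<sigma>Y\<^sup>2"
  define s where "s = sqrt (\<sigma>1\<^sup>2 + \<sigma>2\<^sup>2)"
  define s' where "s' = sqrt ((\<sigma>1 * \<sigma>Y / sqrt v)\<^sup>2 + \<sigma>2\<^sup>2)"
  have v: "0 < v" and s: "0 < s" and s': "0 < s'"
    using \<sigma> by (auto simp: v_def s_def s'_def intro!: add_pos_pos add_nonneg_pos)
  define \<theta>1 \<theta>2 where "\<theta>1 = fst \<theta>" and "\<theta>2 = snd \<theta>"
  let ?N1 = "normal_law \<theta>1 \<sigma>1" and ?N2 = "normal_law \<theta>2 \<sigma>2" and ?NY = "normal_law \<theta>1 \<sigma>Y"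
  have ps: "prob_space ?N1" "prob_space ?N2" "prob_space ?NY"
    using \<sigma> by (auto intro: prob_space_normal_density)
  define Obs where "Obs = ?N1 \<Otimes>\<^sub>M ?N2"
  have Obs: "prob_space Obs" unfolding Obs_def by (intro prob_space_pair ps)
  define P where "P = Obs \<Otimes>\<^sub>M ?NY"
  have P: "prob_space P" unfolding P_def by (intro prob_space_pair ps Obs)
  note scale = distributed_normal_scale
  have lin: "distributed Obs lborel (\<lambda>x. \<alpha> * fst x + \<beta> * snd x)
      (normal_density (\<alpha> * \<theta>1 + \<beta> * \<theta>2) (sqrt ((\<bar>\<alpha>\<bar> * \<sigma>1)\<^sup>2 + (\<bar>\<beta>\<bar> * \<sigma>2)\<^sup>2)))"
    if "\<alpha> \<noteq> 0" "\<beta> \<noteq> 0" for \<alpha> \<beta>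
    unfolding Obs_def using \<sigma> that
    by (intro distributed_pair_add_normal scale ps distributed_normal_law) auto

  define T where "T \<omega> = (fst (fst \<omega>) - snd (fst \<omega>)) / s" for \<omega> :: "(real \<times> real) \<times> real"
  have T: "distributed P lborel T (normal_density ((\<theta>1 - \<theta>2) / s) 1)"
  proof -
    have "distributed Obs lborel (\<lambda>x. (1 / s) * fst x + (- 1 / s) * snd x)
        (normal_density ((1 / s) * \<theta>1 + (- 1 / s) * \<theta>2)
          (sqrt ((\<bar>1 / s\<bar> * \<sigma>1)\<^sup>2 + (\<bar>- 1 / s\<bar> * \<sigma>2)\<^sup>2)))"
      using s by (intro lin) auto
    moreover have "sqrt ((\<bar>1 / s\<bar> * \<sigma>1)\<^sup>2 + (\<bar>- 1 / s\<bar> * \<sigma>2)\<^sup>2) = 1"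
    proof -
      have "(\<bar>1 / s\<bar> * \<sigma>1)\<^sup>2 + (\<bar>- 1 / s\<bar> * \<sigma>2)\<^sup>2 = (\<sigma>1\<^sup>2 + \<sigma>2\<^sup>2) / s\<^sup>2"
        by (simp add: power_mult_distrib power_divide add_divide_distrib)
      also have "\<dots> = 1" using s \<sigma> by (simp add: s_def)
      finally show ?thesis by simp
    qed
    ultimately show ?thesis
      unfolding P_def T_def using distributed_pair_fst[OF ps(3)]
      by (simp add: diff_divide_distrib)
  qed

  define W where "W \<omega> = ((\<sigma>Y\<^sup>2 * fst (fst \<omega>) + \<sigma>1\<^sup>2 * snd \<omega>) / v - snd (fst \<omega>)) / s'"
    for \<omega> :: "(real \<times> real) \<times> real"
  have W: "distributed P lborel W (normal_density ((\<theta>1 - \<theta>2) / s') 1)"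
  proof -
    let ?r = "sqrt ((\<bar>\<sigma>Y\<^sup>2 / v\<bar> * \<sigma>1)\<^sup>2 + (\<bar>-1\<bar> * \<sigma>2)\<^sup>2)"
    have r: "0 < ?r" using \<sigma> by (auto intro!: add_nonneg_pos)
    have D: "distributed P lborel
        (\<lambda>\<omega>. (1 / s') * ((\<sigma>Y\<^sup>2 / v * fst (fst \<omega>) + (-1) * snd (fst \<omega>)) + \<sigma>1\<^sup>2 / v * snd \<omega>))
        (normal_density ((1 / s') * ((\<sigma>Y\<^sup>2 / v * \<theta>1 + (-1) * \<theta>2) + \<sigma>1\<^sup>2 / v * \<theta>1))
          (\<bar>1 / s'\<bar> * sqrt (?r\<^sup>2 + (\<bar>\<sigma>1\<^sup>2 / v\<bar> * \<sigma>Y)\<^sup>2)))"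
    proof (rule scale[OF P])
      show "distributed P lborel 
          (\<lambda>\<omega>. (\<sigma>Y\<^sup>2 / v * fst (fst \<omega>) + (-1) * snd (fst \<omega>)) + \<sigma>1\<^sup>2 / v * snd \<omega>)
          (normal_density ((\<sigma>Y\<^sup>2 / v * \<theta>1 + (-1) * \<theta>2) + \<sigma>1\<^sup>2 / v * \<theta>1)
          (sqrt (?r\<^sup>2 + (\<bar>\<sigma>1\<^sup>2 / v\<bar> * \<sigma>Y)\<^sup>2)))"
        unfolding P_def using \<sigma> v
        by (intro distributed_pair_add_normal[OF Obs ps(3) r _ lin] scale ps distributed_normal_law)
          auto
      show "0 < sqrt (?r\<^sup>2 + (\<bar>\<sigma>1\<^sup>2 / v\<bar> * \<sigma>Y)\<^sup>2)"
        using r by (auto intro!: add_pos_nonneg)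
    qed (use s' in auto)
    have var: "sqrt (?r\<^sup>2 + (\<bar>\<sigma>1\<^sup>2 / v\<bar> * \<sigma>Y)\<^sup>2) = s'"
    proof -
      have "?r\<^sup>2 + (\<bar>\<sigma>1\<^sup>2 / v\<bar> * \<sigma>Y)\<^sup>2 = (\<sigma>Y\<^sup>2 / v * \<sigma>1)\<^sup>2 + (\<sigma>1\<^sup>2 / v * \<sigma>Y)\<^sup>2 + \<sigma>2\<^sup>2"
        using v by (simp add: power_mult_distrib)
      \<comment> \<open>The precision-weighted average has variance
        \<open>1 / (1 / \<sigma>1\<^sup>2 + 1 / \<sigma>Y\<^sup>2)\<close>, the posterior variance of the mean.\<close>
      also have "(\<sigma>Y\<^sup>2 / v * \<sigma>1)\<^sup>2 + (\<sigma>1\<^sup>2 / v * \<sigma>Y)\<^sup>2 = \<sigma>1\<^sup>2 * \<sigma>Y\<^sup>2 * (\<sigma>1\<^sup>2 + \<sigma>Y\<^sup>2) / v\<^sup>2"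
        by (simp add: power_mult_distrib power_divide add_divide_distrib power2_eq_square
            algebra_simps)
      also have "\<dots> = (\<sigma>1 * \<sigma>Y / sqrt v)\<^sup>2"
        using v by (simp add: v_def[symmetric] power_divide power_mult_distrib power2_eq_square[of v])
      finally show ?thesis by (simp add: s'_def)
    qed
    have affine: "(1 / s') * ((\<sigma>Y\<^sup>2 / v * a + (-1) * b) + \<sigma>1\<^sup>2 / v * c)
        = ((\<sigma>Y\<^sup>2 * a + \<sigma>1\<^sup>2 * c) / v - b) / s'" for a b c
      by (simp add: add_divide_distrib diff_divide_distrib)
    have "\<sigma>Y\<^sup>2 * \<theta>1 + \<sigma>1\<^sup>2 * \<theta>1 = \<theta>1 * v" by (simp add: v_def algebra_simps)
    then have mean: "(\<sigma>Y\<^sup>2 * \<theta>1 + \<sigma>1\<^sup>2 * \<theta>1) / v = \<theta>1" using v by simp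
    show ?thesis
      using D s' unfolding affine var mean by (simp add: W_def[abs_def])
  qed

  have Y: "distributed P lborel snd (normal_density \<theta>1 \<sigma>Y)"
    unfolding P_def by (intro distributed_pair_snd Obs ps distributed_normal_law)
  have YX: "distributed P lborel (\<lambda>\<omega>. (-1) * fst (fst \<omega>) + snd \<omega>)
      (normal_density ((-1) * \<theta>1 + \<theta>1) (sqrt ((\<bar>-1\<bar> * \<sigma>1)\<^sup>2 + \<sigma>Y\<^sup>2)))"
    unfolding P_def Obs_def using \<sigma>
    by (intro distributed_pair_add_normal[where X="\<lambda>x. (-1) * fst x"] prob_space_pair
        distributed_pair_fst[where X="\<lambda>x. (-1) * x"] scale distributed_normal_law ps) auto

  \<comment> \<open>The density \<^const>\<open>q_mre\<close> depends on \<open>x\<close> and \<open>y\<close> through \<open>y - x1\<close> alone, which is normal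
    under the product law, so both logarithms are quadratics in normal variables.\<close>
  define L where "L \<omega> = ln (normal_density \<theta>1 \<sigma>Y (snd \<omega>) / q_mre \<sigma>1 \<sigma>Y (fst \<omega>) (snd \<omega>))"
    for \<omega> :: "(real \<times> real) \<times> real"
  have sv: "0 < sqrt v" using v by simp
  have mre_pos: "0 < q_mre \<sigma>1 \<sigma>Y x y" for x y
    using normal_density_pos[OF sv] by (simp add: q_mre_def v_def)
  have L_eq: "L \<omega> = ln (normal_density \<theta>1 \<sigma>Y (snd \<omega>))
      - ln (normal_density 0 (sqrt v) ((-1) * fst (fst \<omega>) + snd \<omega>))" for \<omega>
    unfolding L_def using normal_density_pos[OF \<sigma>(3)] mre_pos
    by (subst ln_div) (auto simp: q_mre_def v_def normal_density_def)
  have int_L: "integrable P L"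
    unfolding L_eq[abs_def] using \<sigma>
    by (intro Bochner_Integration.integrable_diff integrable_ln_normal_density[OF P _ _ Y]
        integrable_ln_normal_density[OF P _ sv YX]) (auto intro!: add_pos_pos)
  have int_W: "integrable P (\<lambda>\<omega>. ln (std_normal_cdf (W \<omega>)))"
    and int_T: "integrable P (\<lambda>\<omega>. ln (std_normal_cdf (T \<omega>)))"
    by (rule integrable_ln_std_normal_cdf[OF P _ W] integrable_ln_std_normal_cdf[OF P _ T], simp)+

  have bayes: "q_bayes \<sigma>1 \<sigma>2 \<sigma>Y (uniform_prior {0..}) (fst \<omega>) (snd \<omega>)
      = q_mre \<sigma>1 \<sigma>Y (fst \<omega>) (snd \<omega>) * (std_normal_cdf (W \<omega>) / std_normal_cdf (T \<omega>))" for \<omega>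
    unfolding q_bayes_uniform_prior_half_plane[OF \<sigma>] W_def T_def s_def s'_def v_def ..
  have bayes_pos: "0 < q_bayes \<sigma>1 \<sigma>2 \<sigma>Y (uniform_prior {0..}) x y" for x y
    using bayes[of "(x, y)"] mre_pos std_normal_cdf_pos by simp
  have L_bayes: "ln (normal_density \<theta>1 \<sigma>Y (snd \<omega>) /
        q_bayes \<sigma>1 \<sigma>2 \<sigma>Y (uniform_prior {0..}) (fst \<omega>) (snd \<omega>))
      = L \<omega> - (ln (std_normal_cdf (W \<omega>)) - ln (std_normal_cdf (T \<omega>)))" for \<omega>
    unfolding bayes L_def
    using normal_density_pos[OF \<sigma>(3), of \<theta>1 "snd \<omega>"] mre_pos[of "fst \<omega>" "snd \<omega>"]
      std_normal_cdf_pos[of "W \<omega>"] std_normal_cdf_pos[of "T \<omega>"]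
    by (simp add: ln_div ln_mult)

  have P_eq: "P = obs_law \<sigma>1 \<sigma>2 \<theta> \<Otimes>\<^sub>M normal_law \<theta>1 \<sigma>Y"
    by (simp add: P_def Obs_def obs_law_def \<theta>1_def \<theta>2_def)
  have "KL_risk \<sigma>1 \<sigma>2 \<sigma>Y \<theta> (q_mre \<sigma>1 \<sigma>Y) = ereal (\<integral>\<omega>. L \<omega> \<partial>P)"
    using KL_risk_eq_integral[OF \<sigma>, of "q_mre \<sigma>1 \<sigma>Y" \<theta>] mre_pos int_L
    unfolding \<theta>1_def[symmetric] P_eq[symmetric] L_def[symmetric] by simp
  moreover have "KL_risk \<sigma>1 \<sigma>2 \<sigma>Y \<theta> (q_bayes \<sigma>1 \<sigma>2 \<sigma>Y (uniform_prior {0..}))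
      = ereal (\<integral>\<omega>. L \<omega> - (ln (std_normal_cdf (W \<omega>)) - ln (std_normal_cdf (T \<omega>))) \<partial>P)"
    using KL_risk_eq_integral[OF \<sigma>, of "q_bayes \<sigma>1 \<sigma>2 \<sigma>Y (uniform_prior {0..})" \<theta>] bayes_pos
      int_L int_W int_T
    unfolding \<theta>1_def[symmetric] P_eq[symmetric] L_bayes by simp
  moreover have "(\<integral>\<omega>. L \<omega> - (ln (std_normal_cdf (W \<omega>)) - ln (std_normal_cdf (T \<omega>))) \<partial>P)
      = (\<integral>\<omega>. L \<omega> \<partial>P) - (mean_ln_cdf ((\<theta>1 - \<theta>2) / s') - mean_ln_cdf ((\<theta>1 - \<theta>2) / s))"
    using int_L int_W int_T
    by (simp add: integral_ln_std_normal_cdf[OF W] integral_ln_std_normal_cdf[OF T])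
  ultimately show ?thesis
    using that[of "\<integral>\<omega>. L \<omega> \<partial>P"] by (simp add: s_def s'_def v_def \<theta>1_def \<theta>2_def)
qed

section \<open>Domination\<close>

theorem theorem4p1:
  fixes \<sigma>1 \<sigma>2 \<sigma>Y :: real
  assumes "\<sigma>1 > 0" and "\<sigma>2 > 0" and "\<sigma>Y > 0"
  shows "dominates \<sigma>1 \<sigma>2 \<sigma>Y {0..} (q_bayes \<sigma>1 \<sigma>2 \<sigma>Y (uniform_prior {0..})) (q_mre \<sigma>1 \<sigma>Y)
    \<and> (\<forall>\<theta> \<in> param_space {0..}.
         KL_risk \<sigma>1 \<sigma>2 \<sigma>Y \<theta> (q_bayes \<sigma>1 \<sigma>2 \<sigma>Y (uniform_prior {0..}))
           = KL_risk \<sigma>1 \<sigma>2 \<sigma>Y \<theta> (q_mre \<sigma>1 \<sigma>Y)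
         \<longleftrightarrow> fst \<theta> = snd \<theta>)"
proof -
  let ?Rb = "\<lambda>\<theta>. KL_risk \<sigma>1 \<sigma>2 \<sigma>Y \<theta> (q_bayes \<sigma>1 \<sigma>2 \<sigma>Y (uniform_prior {0..}))"
  let ?Rm = "\<lambda>\<theta>. KL_risk \<sigma>1 \<sigma>2 \<sigma>Y \<theta> (q_mre \<sigma>1 \<sigma>Y)"
  define s where "s = sqrt (\<sigma>1\<^sup>2 + \<sigma>2\<^sup>2)"
  define s' where "s' = sqrt ((\<sigma>1 * \<sigma>Y / sqrt (\<sigma>1\<^sup>2 + \<sigma>Y\<^sup>2))\<^sup>2 + \<sigma>2\<^sup>2)"
  have s': "0 < s'" using assms by (auto simp: s'_def intro!: add_nonneg_pos)
  have "(\<sigma>1 * \<sigma>Y / sqrt (\<sigma>1\<^sup>2 + \<sigma>Y\<^sup>2))\<^sup>2 = \<sigma>1\<^sup>2 * (\<sigma>Y\<^sup>2 / (\<sigma>1\<^sup>2 + \<sigma>Y\<^sup>2))"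
    by (simp add: power_divide power_mult_distrib)
  also have "\<dots> < \<sigma>1\<^sup>2 * 1"
    using assms by (intro mult_strict_left_mono) (auto simp: add_pos_pos)
  \<comment> \<open>Averaging \<open>X1\<close> with \<open>Y1\<close> reduces the variance: this strict inequality is the whole gain.\<close>
  finally have less: "s' < s" by (simp add: s_def s'_def)
  have eq: "?Rb \<theta> = ?Rm \<theta>" if "fst \<theta> = snd \<theta>" for \<theta>
    by (rule KL_risk_q_mre_q_bayes[OF assms, of \<theta>]) (simp add: that)
  have lt: "?Rb \<theta> < ?Rm \<theta>" if "snd \<theta> < fst \<theta>" for \<theta>
  proof -
    have "(fst \<theta> - snd \<theta>) / s < (fst \<theta> - snd \<theta>) / s'"
      using that less s' by (intro divide_strict_left_mono) auto
    then have "mean_ln_cdf ((fst \<theta> - snd \<theta>) / s) < mean_ln_cdf ((fst \<theta> - snd \<theta>) / s')"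
      by (rule strict_monoD[OF mean_ln_cdf_strict_mono])
    then show ?thesis unfolding s_def s'_def
      by - (rule KL_risk_q_mre_q_bayes[OF assms, of \<theta>], simp)
  qed
  have "?Rb \<theta> \<le> ?Rm \<theta> \<and> (?Rb \<theta> = ?Rm \<theta> \<longleftrightarrow> fst \<theta> = snd \<theta>)" if "\<theta> \<in> param_space {0..}" for \<theta>
    using eq[of \<theta>] lt[of \<theta>] that by (cases "fst \<theta> = snd \<theta>") (auto simp: param_space_def)
  moreover have "\<exists>\<theta> \<in> param_space {0..}. ?Rb \<theta> < ?Rm \<theta>"
    using lt[of "(1, 0)"] by (intro bexI[of _ "(1, 0)"]) (auto simp: param_space_def)
  ultimately show ?thesis unfolding dominates_def by simp
qed

end
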